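(* Let $(M,d)$ be a compact metric space and let $\alpha\colon\mathbb{Z}^k\to\operatorname{Homeo}(M)$ be an action generated by commuting homeomorphisms $f_1,\dots,f_k$ of $M$ (so $f_i=\alpha(\mathbf{e}_i)$, where $\mathbf{e}_1,\dots,\mathbf{e}_k$ is the standard basis of $\mathbb{Z}^k$). Then $\alpha$ is cohomologically $C^0$-stable if and only if some finite-index sublattice $\Lambda\le\mathbb{Z}^k$ acts trivially on $M$, i.e. the group $\langle f_1,\dots,f_k\rangle\le\operatorname{Homeo}(M)$ is finite.
   Context: $C^0(M)$ denotes the Banach space of real continuous functions on $M$ with the uniform norm $\|\phi\|_{C^0}=\sup_{x\in M}|\phi(x)|$. For a finitely generated group $G$ and an action $\alpha\colon G\to\operatorname{Homeo}(M)$ write $g\cdot x$ for $\alpha(g)(x)$, and fix a finite symmetric generating set $S=S^{-1}$ of $G$ with $e\notin S$ (here $G=\mathbb{Z}^k$, written additively). A (real, continuous) cocycle over $\alpha$ is a map $c\colon G\times M\to\mathbb{R}$ such that $c(g,\cdot)\in C^0(M)$ for every $g\in G$ and $c(gh,x)=c(g,h\cdot x)+c(h,x)$ for all $g,h\in G$, $x\in M$. The linear space of cocycles is denoted $Z^1(\alpha)$ and is given the norm $\|c\|=\max_{s\in S}\|c(s,\cdot)\|_{C^0}$ (different finite generating sets give equivalent norms). Every $u\in C^0(M)$ determines the coboundary $\delta u\in Z^1(\alpha)$, $(\delta u)(g,x)=u(g\cdot x)-u(x)$, and $B(\alpha)=\delta(C^0(M))$. The action $\alpha$ is called cohomologically $C^0$-stable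 when $B(\alpha)$ is closed in $Z^1(\alpha)$. *)

theory Defs
  imports "HOL-Analysis.Analysis" "HOL-Algebra.Algebra"
begin

text \<open>
  The compact metric space \<open>M\<close> is a type of class \<open>metric_space\<close> whose universe is compact. The Banach
  space \<open>C^0(M)\<close> is then the library type \<open>'m \<Rightarrow>\<^sub>C real\<close> of bounded continuous functions with the
  supremum norm; by compactness boundedness is automatic.
\<close>

definition homeo_group :: "('m::topological_space \<Rightarrow> 'm) monoid" where
  "homeo_group = \<lparr>carrier = {f. \<exists>g. homeomorphism UNIV UNIV f g}, monoid.mult = (\<circ>), one = id\<rparr>"

definition int_lattice :: "(int ^ 'k::finite) monoid" where
  "int_lattice = \<lparr>carrier = UNIV, monoid.mult = (+), one = 0\<rparr>"

definition symmetric_generating_set :: "('g, 'b) monoid_scheme \<Rightarrow> 'g set \<Rightarrow> bool" where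
  "symmetric_generating_set G S \<longleftrightarrow>
     finite S \<and> S \<subseteq> carrier G \<and> (\<lambda>s. inv\<^bsub>G\<^esub> s) ` S = S \<and> \<one>\<^bsub>G\<^esub> \<notin> S \<and> generate G S = carrier G"

text \<open>
  In what follows an action of \<open>G\<close> on \<open>M\<close> is an element \<open>\<alpha>\<close> of \<open>hom G homeo_group\<close>. Cocycles are
  required to be extensional on \<open>carrier G\<close>, so that equality of cocycles is equality of functions.
\<close>

definition cocycles ::
    "('g, 'b) monoid_scheme \<Rightarrow> ('g \<Rightarrow> 'm \<Rightarrow> 'm) \<Rightarrow> ('g \<Rightarrow> ('m::metric_space \<Rightarrow>\<^sub>C real)) set" where
  "cocycles G \<alpha> = {c \<in> carrier G \<rightarrow>\<^sub>E (UNIV :: ('m \<Rightarrow>\<^sub>C real) set).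
     \<forall>g\<in>carrier G. \<forall>h\<in>carrier G. \<forall>x. c (g \<otimes>\<^bsub>G\<^esub> h) x = c g (\<alpha> h x) + c h x}"

text \<open>For nonempty \<open>S\<close> only, since the maximum of the empty set is unspecified.\<close>

definition cocycle_norm :: "'g set \<Rightarrow> ('g \<Rightarrow> ('m::metric_space \<Rightarrow>\<^sub>C real)) \<Rightarrow> real" where
  "cocycle_norm S c = Max ((\<lambda>s. norm (c s)) ` S)"

text \<open>\<open>Bcontfun\<close> is meaningful here because \<open>u \<circ> \<alpha> g - u\<close> is bounded and continuous; see
  \<open>coboundary_apply\<close> below.\<close>

definition coboundary ::
    "('g, 'b) monoid_scheme \<Rightarrow> ('g \<Rightarrow> 'm \<Rightarrow> 'm) \<Rightarrow> ('m::metric_space \<Rightarrow>\<^sub>C real) \<Rightarrow> 'g \<Rightarrow> ('m \<Rightarrow>\<^sub>C real)"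
  where "coboundary G \<alpha> u = (\<lambda>g\<in>carrier G. Bcontfun (\<lambda>x. u (\<alpha> g x) - u x))"

definition coboundaries ::
    "('g, 'b) monoid_scheme \<Rightarrow> ('g \<Rightarrow> 'm \<Rightarrow> 'm) \<Rightarrow> ('g \<Rightarrow> ('m::metric_space \<Rightarrow>\<^sub>C real)) set" where
  "coboundaries G \<alpha> = range (coboundary G \<alpha>)"

definition cocycle_topology ::
    "('g, 'b) monoid_scheme \<Rightarrow> 'g set \<Rightarrow> ('g \<Rightarrow> 'm \<Rightarrow> 'm) \<Rightarrow> ('g \<Rightarrow> ('m::metric_space \<Rightarrow>\<^sub>C real)) topology"
  where "cocycle_topology G S \<alpha> =
    Metric_space.mtopology (cocycles G \<alpha>) (\<lambda>c c'. cocycle_norm S (\<lambda>g. c g - c' g))"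

definition cohomologically_C0_stable ::
    "('g, 'b) monoid_scheme \<Rightarrow> 'g set \<Rightarrow> ('g \<Rightarrow> 'm::metric_space \<Rightarrow> 'm) \<Rightarrow> bool" where
  "cohomologically_C0_stable G S \<alpha> \<longleftrightarrow>
     closedin (cocycle_topology G S \<alpha>) (coboundaries G \<alpha>)"

lemma group_int_lattice: "group int_lattice"
proof (rule groupI)
  fix v :: "int ^ 'k"
  show "\<exists>w\<in>carrier int_lattice. w \<otimes>\<^bsub>int_lattice\<^esub> v = \<one>\<^bsub>int_lattice\<^esub>"
    by (rule bexI[of _ "- v"]) (auto simp: int_lattice_def)
qed (auto simp: int_lattice_def add.assoc)

lemma group_homeo_group: "group homeo_group"
proof (rule groupI)
  fix f :: "'a \<Rightarrow> 'a"
  assume "f \<in> carrier homeo_group"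
  then obtain g where g: "homeomorphism UNIV UNIV f g" by (auto simp: homeo_group_def)
  then have "g \<circ> f = id" by (auto simp: homeomorphism_def)
  with g show "\<exists>g\<in>carrier homeo_group. g \<otimes>\<^bsub>homeo_group\<^esub> f = \<one>\<^bsub>homeo_group\<^esub>"
    by (intro bexI[of _ g]) (auto simp: homeo_group_def dest: homeomorphism_symD)
next
  show "\<one>\<^bsub>homeo_group\<^esub> \<in> carrier homeo_group"
    by (auto simp: homeo_group_def homeomorphism_def intro!: exI[of _ id])
qed (auto simp: homeo_group_def comp_assoc intro: homeomorphism_compose)

lemma coboundary_apply:
  fixes u :: "'m::metric_space \<Rightarrow>\<^sub>C real"
  assumes "\<alpha> \<in> hom G homeo_group" "g \<in> carrier G"
  shows "coboundary G \<alpha> u g x = u (\<alpha> g x) - u x"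
proof -
  obtain h where "homeomorphism UNIV UNIV (\<alpha> g) h"
    using assms by (fastforce simp: hom_def homeo_group_def)
  then have "continuous_on UNIV (\<alpha> g)" by (simp add: homeomorphism_def)
  then have "continuous_on UNIV (\<lambda>x. u (\<alpha> g x))"
    by (rule continuous_on_compose2[OF continuous_on_apply_bcontfun]) auto
  moreover have "bounded (range (\<lambda>x. u (\<alpha> g x)))"
    by (rule bounded_subset[OF bounded_apply_bcontfun[of u]]) auto
  ultimately have "(\<lambda>x. u (\<alpha> g x) - u x) \<in> bcontfun"
    by (auto simp: bcontfun_def intro!: continuous_on_diff bounded_minus_comp)
  then show ?thesis using assms(2) by (simp add: coboundary_def Bcontfun_inverse)
qed

lemma coboundaries_subset_cocycles:
  assumes "group G" "\<alpha> \<in> hom G homeo_group"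
  shows "coboundaries G \<alpha> \<subseteq> cocycles G \<alpha>"
proof -
  have "\<alpha> (g \<otimes>\<^bsub>G\<^esub> h) x = \<alpha> g (\<alpha> h x)" if "g \<in> carrier G" "h \<in> carrier G" for g h x
    using assms(2) that by (auto simp: hom_def homeo_group_def)
  then show ?thesis
    using assms
    by (auto simp: coboundaries_def cocycles_def coboundary_apply group.is_monoid monoid.m_closed)
       (simp add: coboundary_def)
qed

lemma Metric_space_cocycles:
  fixes \<alpha> :: "'g \<Rightarrow> 'm::metric_space \<Rightarrow> 'm"
  assumes G: "group G" and \<alpha>: "\<alpha> \<in> hom G homeo_group"
    and S: "symmetric_generating_set G S" "S \<noteq> {}"
  shows "Metric_space (cocycles G \<alpha>) (\<lambda>c c'. cocycle_norm S (\<lambda>g. c g - c' g))"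
proof -
  interpret group G by (rule G)
  have fin: "finite S" and sub: "S \<subseteq> carrier G" and gen: "generate G S = carrier G"
    using S by (auto simp: symmetric_generating_set_def)
  define d where "d = (\<lambda>c c' :: 'g \<Rightarrow> ('m \<Rightarrow>\<^sub>C real). cocycle_norm S (\<lambda>g. c g - c' g))"
  have le: "norm (c s - c' s) \<le> d c c'" if "s \<in> S" for s c c'
    using fin that by (auto simp: d_def cocycle_norm_def)
  have leI: "d c c' \<le> r" if "\<And>s. s \<in> S \<Longrightarrow> norm (c s - c' s) \<le> r" for c c' r
    using fin S(2) that by (simp add: d_def cocycle_norm_def)
  have ge0: "0 \<le> d c c'" for c c'
    using S(2) le norm_ge_zero order_trans by blast
  have eq: "c = c'" if c: "c \<in> cocycles G \<alpha>" "c' \<in> cocycles G \<alpha>" and d0: "d c c' = 0" for c c'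
  proof -
    have "\<alpha> \<one>\<^bsub>G\<^esub> = \<one>\<^bsub>homeo_group\<^esub>"
      using \<alpha> group_homeo_group
      by (intro group_hom.hom_one) (simp add: group_hom_def group_hom_axioms_def G)
    then have act: "\<alpha> \<one>\<^bsub>G\<^esub> x = x" "\<And>g h. g \<in> carrier G \<Longrightarrow> h \<in> carrier G \<Longrightarrow> \<alpha> (g \<otimes>\<^bsub>G\<^esub> h) x = \<alpha> g (\<alpha> h x)" for x
      using \<alpha> by (auto simp: hom_def homeo_group_def)
    have coc: "b (g \<otimes>\<^bsub>G\<^esub> h) x = b g (\<alpha> h x) + b h x"
      if "b \<in> {c, c'}" "g \<in> carrier G" "h \<in> carrier G" for b g h x
      using c that by (auto simp: cocycles_def)
    have one: "b \<one>\<^bsub>G\<^esub> x = 0" if "b \<in> {c, c'}" for b x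
      using coc[OF that one_closed one_closed, of x] act(1) by simp
    have inv: "b (inv\<^bsub>G\<^esub> g) x = - b g (\<alpha> (inv\<^bsub>G\<^esub> g) x)" if "b \<in> {c, c'}" "g \<in> carrier G" for b g x
      using coc[OF that inv_closed[OF that(2)], of x] one[OF that(1), of x] that(2) by simp
    have S0: "c s = c' s" if "s \<in> S" for s
      using le[OF that, of c c'] d0 by simp
    have "c g = c' g" if "g \<in> generate G S" for g
      using that
    proof (induction rule: generate.induct)
      case one then show ?case by (auto intro!: bcontfun_eqI simp: \<open>\<And>b x. b \<in> {c, c'} \<Longrightarrow> b \<one>\<^bsub>G\<^esub> x = 0\<close>)
    next
      case (incl h) then show ?case by (rule S0)
    next
      case (inv h) 
      then have "h \<in> carrier G" using sub by auto
      then show ?case using S0[OF inv]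
        by (intro bcontfun_eqI) (simp add: \<open>\<And>b g x. b \<in> {c, c'} \<Longrightarrow> g \<in> carrier G \<Longrightarrow> b (inv\<^bsub>G\<^esub> g) x = - b g (\<alpha> (inv\<^bsub>G\<^esub> g) x)\<close>)
    next
      case (eng g h)
      then show ?case using gen by (intro bcontfun_eqI) (simp add: coc)
    qed
    then show ?thesis using c gen by (intro extensionalityI[of c "carrier G"]) (auto simp: cocycles_def PiE_def)
  qed
  have "Metric_space (cocycles G \<alpha>) d"
  proof
    fix c c' c''
    show "0 \<le> d c c'" by (rule ge0)
    show "d c c' = d c' c" by (simp add: d_def cocycle_norm_def norm_minus_commute)
    assume c: "c \<in> cocycles G \<alpha>" "c' \<in> cocycles G \<alpha>"
    have "d c c = 0" by (rule antisym[OF leI ge0]) simp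
    then show "(d c c' = 0) = (c = c')" using eq[OF c] by blast
    show "d c c'' \<le> d c c' + d c' c''"
    proof (rule leI)
      fix s assume "s \<in> S"
      have "norm (c s - c'' s) \<le> norm (c s - c' s) + norm (c' s - c'' s)"
        using norm_triangle_ineq[of "c s - c' s" "c' s - c'' s"] by simp
      then show "norm (c s - c'' s) \<le> d c c' + d c' c''"
        using le[OF \<open>s \<in> S\<close>, of c c'] le[OF \<open>s \<in> S\<close>, of c' c''] by linarith
    qed
  qed
  then show ?thesis by (simp add: d_def)
qed

end

theory Submission
  imports Defs
begin

text \<open>
  Stability and finiteness of \<open>\<langle>f\<^sub>1, \<dots>, f\<^sub>k\<rangle>\<close> are compared through the image \<open>\<alpha>(\<int>\<^sup>k)\<close> of the action,
  which is that group because the standard basis generates \<open>\<int>\<^sup>k\<close>. It is finite exactly when some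
  finite-index subgroup acts trivially, by the isomorphism theorem. What remains is: the coboundaries
  are closed if and only if the image is finite.

  If the image is finite, a limit \<open>c\<close> of coboundaries depends on \<open>g\<close> only through \<open>\<alpha>(g)\<close>, since each
  coboundary does. Averaging then trivialises it: \<open>u = - (1/N) \<Sum>\<^sub>r c(r, \<cdot>)\<close>, with one \<open>r\<close> for each
  element of the image, satisfies \<open>\<delta>u = c\<close>.

  If the coboundaries are closed, the open mapping principle says that a function \<open>u\<close> with small
  \<open>\<delta>u\<close> on the generators has small oscillation along every orbit. This fails as soon as no finite
  \<open>F \<subseteq> G\<close> satisfies \<open>F x = G x\<close> for all \<open>x\<close>: with \<open>F\<close> a large ball of the Cayley graph, choose
  \<open>z\<close> and \<open>h\<close> with \<open>h z \<notin> F z\<close>, take a bump function at \<open>h z\<close> that vanishes on \<open>F z\<close>, and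
  spread it out along the action. The result changes by at most \<open>1/n\<close> under a generator and still equals \<open>1\<close> at
  \<open>h z\<close> and \<open>0\<close> at \<open>z\<close> (\<open>almost_invariant_function\<close>). Instead of the open mapping theorem a gliding
  hump is used (\<open>almost_invariant_imp_unstable\<close>): large multiples of such functions are added up
  so fast that the coboundaries of the partial sums converge, while the limit cocycle is unbounded on
  \<open>G \<times> M\<close>; a coboundary \<open>\<delta>u\<close> is bounded by \<open>2 \<parallel>u\<parallel>\<close>.

  Hence stability gives a finite \<open>F\<close> that covers every orbit. For \<open>\<int>\<^sup>k\<close> this bounds the image: among
  \<open>0, v, \<dots>, |F| v\<close> two elements move \<open>x\<close> to the same point, so \<open>j v\<close> fixes \<open>x\<close> for some
  \<open>1 \<le> j \<le> |F|\<close>, and \<open>|F|! \<int>\<^sup>k\<close> acts trivially.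
\<close>

section \<open>Cocycles over a finitely generated group\<close>

lemma apply_bcontfun_sum:
  fixes c :: "'a \<Rightarrow> 'm::topological_space \<Rightarrow>\<^sub>C real"
  shows "apply_bcontfun (\<Sum>a\<in>A. c a) x = (\<Sum>a\<in>A. c a x)"
  by (induction A rule: infinite_finite_induct) auto

lemma tendsto_apply_bcontfun:
  fixes c :: "nat \<Rightarrow> 'm::topological_space \<Rightarrow>\<^sub>C real"
  assumes "c \<longlonglongrightarrow> l"
  shows "(\<lambda>n. c n x) \<longlonglongrightarrow> l x"
  using tendsto_uniform_limitI[OF tendsto_bcontfun_uniform_limit[OF assms], of x] by simp

locale topological_action = group G for G (structure) +
  fixes \<alpha> :: "'a \<Rightarrow> 'm::metric_space \<Rightarrow> 'm" and S :: "'a set"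
  assumes action: "\<alpha> \<in> hom G homeo_group"
    and S: "symmetric_generating_set G S"
    and S_nonempty: "S \<noteq> {}"
begin

abbreviation \<delta> :: "('m \<Rightarrow>\<^sub>C real) \<Rightarrow> 'a \<Rightarrow> ('m \<Rightarrow>\<^sub>C real)" where
  "\<delta> u \<equiv> coboundary G \<alpha> u"

lemma finite_S: "finite S" and S_closed: "s \<in> S \<Longrightarrow> s \<in> carrier G"
  and S_inv: "s \<in> S \<Longrightarrow> inv s \<in> S" and generate_S: "generate G S = carrier G"
  using S by (auto simp: symmetric_generating_set_def)

sublocale hom: group_hom G homeo_group \<alpha>
  using action group_homeo_group is_group by (simp add: group_hom_def group_hom_axioms_def)

text \<open>Otherwise the simplifier replaces \<open>\<alpha> \<one>\<close> by the identity of the homeomorphism group, whose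
  action on points it cannot evaluate.\<close>

declare hom.hom_one [simp del]

lemma act_one: "\<alpha> \<one> x = x"
  using hom.hom_one by (simp add: homeo_group_def)

lemma act_mult:
  "g \<in> carrier G \<Longrightarrow> h \<in> carrier G \<Longrightarrow> \<alpha> (g \<otimes> h) x = \<alpha> g (\<alpha> h x)"
  using hom.hom_mult by (simp add: homeo_group_def)

lemma act_inv: "g \<in> carrier G \<Longrightarrow> \<alpha> (inv g) (\<alpha> g x) = x" "g \<in> carrier G \<Longrightarrow> \<alpha> g (\<alpha> (inv g) x) = x"
  by (metis act_mult act_one inv_closed l_inv r_inv)+

lemma continuous_act:
  assumes "g \<in> carrier G"
  shows "continuous_on UNIV (\<alpha> g)"
  using hom.hom_closed[OF assms] by (auto simp: homeo_group_def homeomorphism_def)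

lemmas coboundary_apply' = coboundary_apply[OF action]

lemma coboundary_cocycle: "\<delta> u \<in> cocycles G \<alpha>"
  using coboundaries_subset_cocycles[OF is_group action] by (auto simp: coboundaries_def)

lemma cocycle_mult:
  "c \<in> cocycles G \<alpha> \<Longrightarrow> g \<in> carrier G \<Longrightarrow> h \<in> carrier G \<Longrightarrow> c (g \<otimes> h) x = c g (\<alpha> h x) + c h x"
  by (auto simp: cocycles_def)

lemma cocycle_diff:
  assumes "c \<in> cocycles G \<alpha>" "b \<in> cocycles G \<alpha>"
  shows "(\<lambda>g\<in>carrier G. c g - b g) \<in> cocycles G \<alpha>"
  using assms by (auto simp: cocycles_def)

lemma cocycle_eqI:
  assumes "c \<in> cocycles G \<alpha>" "b \<in> cocycles G \<alpha>" "\<And>g x. g \<in> carrier G \<Longrightarrow> c g x = b g x"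
  shows "c = b"
proof (rule extensionalityI[of c "carrier G"])
  show "c \<in> extensional (carrier G)" "b \<in> extensional (carrier G)"
    using assms(1,2) by (simp_all add: cocycles_def PiE_def)
  show "c g = b g" if "g \<in> carrier G" for g
    by (rule bcontfun_eqI) (rule assms(3)[OF that])
qed

lemma cocycle_norm_less_iff: "cocycle_norm S c < e \<longleftrightarrow> (\<forall>s\<in>S. norm (c s) < e)"
  using finite_S S_nonempty by (simp add: cocycle_norm_def)

text \<open>This form of closedness involves the generators only; both directions of the equivalence with
  finiteness work with it.\<close>

lemma stable_iff:
  "cohomologically_C0_stable G S \<alpha> \<longleftrightarrow>
    (\<forall>c\<in>cocycles G \<alpha>. (\<forall>e>0. \<exists>u. \<forall>s\<in>S. norm (c s - \<delta> u s) < e) \<longrightarrow> (\<exists>u. c = \<delta> u))"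
proof -
  interpret Z: Metric_space "cocycles G \<alpha>" "\<lambda>c b. cocycle_norm S (\<lambda>g. c g - b g)"
    by (rule Metric_space_cocycles[OF is_group action S S_nonempty])
  have ball: "\<delta> u \<in> Z.mball c e \<longleftrightarrow> c \<in> cocycles G \<alpha> \<and> (\<forall>s\<in>S. norm (c s - \<delta> u s) < e)" for u c e
    by (simp add: cocycle_norm_less_iff coboundary_cocycle)
  have "disjnt (coboundaries G \<alpha>) (Z.mball c e) \<longleftrightarrow> \<not> (\<exists>u. \<forall>s\<in>S. norm (c s - \<delta> u s) < e)"
    if "c \<in> cocycles G \<alpha>" for c e
    using that ball[of _ c e] unfolding disjnt_iff coboundaries_def by blast
  moreover have "coboundaries G \<alpha> \<subseteq> cocycles G \<alpha>"
    by (rule coboundaries_subset_cocycles[OF is_group action])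
  moreover have "c \<in> coboundaries G \<alpha> \<longleftrightarrow> (\<exists>u. c = \<delta> u)" for c
    unfolding coboundaries_def by blast
  ultimately show ?thesis
    unfolding cohomologically_C0_stable_def cocycle_topology_def Z.closedin_metric by blast
qed

text \<open>Evaluation at any group element is continuous for the norm on the generators: split a word into
  letters and use the cocycle identity.\<close>

lemma cocycle_norm_bound:
  assumes "g \<in> carrier G"
  shows "\<exists>K. \<forall>c\<in>cocycles G \<alpha>. \<forall>e. (\<forall>s\<in>S. norm (c s) \<le> e) \<longrightarrow> norm (c g) \<le> K * e"
proof -
  have "g \<in> generate G S" using assms generate_S by simp
  then show ?thesis
  proof (induction rule: generate.induct)
    case one
    have "c \<one> = 0" if "c \<in> cocycles G \<alpha>" for c
      using cocycle_mult[OF that, of \<one> \<one>] by (intro bcontfun_eqI) (simp add: act_one)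
    then show ?case by (intro exI[of _ 0]) simp
  next
    case (incl h)
    then show ?case by (intro exI[of _ 1]) simp
  next
    case (inv h)
    then show ?case using S_inv by (intro exI[of _ 1]) simp
  next
    case (eng g h)
    then obtain K L where
      K: "\<And>c e. c \<in> cocycles G \<alpha> \<Longrightarrow> (\<forall>s\<in>S. norm (c s) \<le> e) \<Longrightarrow> norm (c g) \<le> K * e" and
      L: "\<And>c e. c \<in> cocycles G \<alpha> \<Longrightarrow> (\<forall>s\<in>S. norm (c s) \<le> e) \<Longrightarrow> norm (c h) \<le> L * e"
      by blast
    have gh: "g \<in> carrier G" "h \<in> carrier G"
      using eng generate_S by auto
    have "norm (c (g \<otimes> h)) \<le> (K + L) * e"
      if "c \<in> cocycles G \<alpha>" "\<forall>s\<in>S. norm (c s) \<le> e" for c e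
    proof (rule norm_bound)
      fix x
      have "norm (c g (\<alpha> h x)) \<le> K * e" "norm (c h x) \<le> L * e"
        using K[OF that] L[OF that] norm_bounded order_trans by blast+
      then show "norm (c (g \<otimes> h) x) \<le> (K + L) * e"
        using norm_triangle_ineq[of "c g (\<alpha> h x)" "c h x"]
        by (simp add: cocycle_mult[OF that(1) gh] algebra_simps)
    qed
    then show ?case by blast
  qed
qed

section \<open>Finite image implies stability\<close>

text \<open>Every coboundary \<open>u (\<alpha> g x) - u x\<close> depends on \<open>g\<close> only through \<open>\<alpha> g\<close>, and this
  property survives limits.\<close>

lemma coboundary_limit_factors:
  assumes c: "c \<in> cocycles G \<alpha>"
    and lim: "\<And>e. e > 0 \<Longrightarrow> \<exists>u. \<forall>s\<in>S. norm (c s - \<delta> u s) < e"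
    and gh: "g \<in> carrier G" "h \<in> carrier G" "\<alpha> g = \<alpha> h"
  shows "c g = c h"
proof -
  obtain K L where
    K: "\<And>c e. c \<in> cocycles G \<alpha> \<Longrightarrow> (\<forall>s\<in>S. norm (c s) \<le> e) \<Longrightarrow> norm (c g) \<le> K * e" and
    L: "\<And>c e. c \<in> cocycles G \<alpha> \<Longrightarrow> (\<forall>s\<in>S. norm (c s) \<le> e) \<Longrightarrow> norm (c h) \<le> L * e"
    using cocycle_norm_bound gh by meson
  have small: "norm (c g - c h) \<le> (K + L) * e" if e: "e > 0" for e
  proof -
    obtain u where u: "\<forall>s\<in>S. norm (c s - \<delta> u s) < e" using lim[OF e] by blast
    let ?d = "\<lambda>g\<in>carrier G. c g - \<delta> u g"
    have d: "?d \<in> cocycles G \<alpha>" "\<forall>s\<in>S. norm (?d s) \<le> e"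
      using cocycle_diff[OF c coboundary_cocycle] u S_closed by (auto intro: less_imp_le)
    have "\<delta> u g = \<delta> u h"
      using gh by (intro bcontfun_eqI) (simp add: coboundary_apply')
    then have "c g - c h = ?d g - ?d h" using gh by simp
    then have "norm (c g - c h) \<le> norm (?d g) + norm (?d h)"
      by (simp only: norm_triangle_ineq4)
    with K[OF d] L[OF d] show ?thesis by (simp add: algebra_simps)
  qed
  have "norm (c g - c h) \<le> 0"
  proof (rule ccontr)
    assume pos: "\<not> norm (c g - c h) \<le> 0"
    have "norm (c g - c h) \<le> K + L" using small[OF zero_less_one] by simp
    with pos have KL: "K + L > 0" by (meson less_le_trans not_le)
    let ?e = "norm (c g - c h) / (2 * (K + L))"
    have "(K + L) * ?e = norm (c g - c h) / 2" "?e > 0"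
      using KL pos by (simp_all add: field_simps)
    then show False
      using small[of ?e] pos by linarith
  qed
  then show ?thesis by simp
qed

text \<open>Summing \<open>c (r \<otimes> h) x = c r (\<alpha> h x) + c h x\<close> over representatives \<open>r\<close> of the image
  exhibits \<open>c\<close> as the coboundary of minus the average of the \<open>c r\<close>: right multiplication by
  \<open>h\<close> only permutes the elements of the image.\<close>

theorem finite_image_imp_stable:
  assumes fin: "finite (\<alpha> ` carrier G)"
  shows "cohomologically_C0_stable G S \<alpha>"
  unfolding stable_iff
proof (intro ballI impI)
  fix c
  assume c: "c \<in> cocycles G \<alpha>" and lim: "\<forall>e>0. \<exists>u. \<forall>s\<in>S. norm (c s - \<delta> u s) < e"
  obtain R where R: "R \<subseteq> carrier G" "inj_on \<alpha> R" "\<alpha> ` carrier G = \<alpha> ` R"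
    using subset_image_inj[of "\<alpha> ` carrier G" \<alpha> "carrier G"] by auto
  have finR: "finite R" using fin R finite_imageD by metis
  have "R \<noteq> {}" using R(3) one_closed by blast
  with finR have N: "card R > 0" by (simp add: card_gt_0_iff)
  define u where "u = - (1 / real (card R)) *\<^sub>R (\<Sum>r\<in>R. c r)"
  have "c h x = \<delta> u h x" if h: "h \<in> carrier G" for h x
  proof -
    have "\<exists>r'\<in>R. \<alpha> r' = \<alpha> (r \<otimes> h)" if "r \<in> R" for r
      using R that h by (metis imageE imageI m_closed subsetD)
    then obtain \<rho> where \<rho>: "\<And>r. r \<in> R \<Longrightarrow> \<rho> r \<in> R" "\<And>r. r \<in> R \<Longrightarrow> \<alpha> (\<rho> r) = \<alpha> (r \<otimes> h)"
      by metis
    have "inj_on \<rho> R"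
    proof (rule inj_onI)
      fix r r' assume r: "r \<in> R" "r' \<in> R" "\<rho> r = \<rho> r'"
      then have "\<alpha> (r \<otimes> h) = \<alpha> (r' \<otimes> h)" using \<rho>(2) by metis
      then have "\<alpha> r (\<alpha> h y) = \<alpha> r' (\<alpha> h y)" for y
        using r R(1) h by (metis act_mult subsetD)
      then have "\<alpha> r y = \<alpha> r' y" for y
        using act_inv(2)[OF h] by metis
      then show "r = r'" using r R(2) by (auto dest: inj_onD)
    qed
    then have bij: "bij_betw \<rho> R R"
      using endo_inj_surj[OF finR, of \<rho>] \<rho>(1) by (auto simp: bij_betw_def)
    have "(\<Sum>r\<in>R. c r (\<alpha> h x)) + real (card R) * c h x = (\<Sum>r\<in>R. c (r \<otimes> h) x)"
      using R(1) by (auto simp: cocycle_mult[OF c _ h] sum.distrib subset_iff intro!: sum.cong)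
    also have "\<dots> = (\<Sum>r\<in>R. c (\<rho> r) x)"
    proof (rule sum.cong)
      fix r assume r: "r \<in> R"
      then have "r \<otimes> h \<in> carrier G" "\<rho> r \<in> carrier G" "\<alpha> (r \<otimes> h) = \<alpha> (\<rho> r)"
        using R(1) \<rho>[OF r] h by auto
      then show "c (r \<otimes> h) x = c (\<rho> r) x"
        using coboundary_limit_factors[OF c lim[rule_format]] by metis
    qed simp
    also have "\<dots> = (\<Sum>r\<in>R. c r x)"
      by (rule sum.reindex_bij_betw[OF bij])
    finally show ?thesis
      using N by (simp add: coboundary_apply' h u_def apply_bcontfun_sum field_simps)
  qed
  then show "\<exists>u. c = \<delta> u"
    using cocycle_eqI[OF c coboundary_cocycle] by blast
qed

end

section \<open>Almost invariant functions that vary along an orbit\<close>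

lemma continuous_on_Max_image:
  fixes f :: "'i \<Rightarrow> 'a::topological_space \<Rightarrow> real"
  assumes "finite I" "I \<noteq> {}" "\<And>i. i \<in> I \<Longrightarrow> continuous_on U (f i)"
  shows "continuous_on U (\<lambda>x. Max ((\<lambda>i. f i x) ` I))"
  using assms
proof (induction I rule: finite_ne_induct)
  case (insert i I)
  then have "(\<lambda>x. Max ((\<lambda>i. f i x) ` insert i I)) = (\<lambda>x. max (f i x) (Max ((\<lambda>i. f i x) ` I)))"
    by (intro ext) simp
  with insert show ?case by (auto intro: continuous_on_max)
qed simp

lemma continuous_separation_from_finite:
  fixes x :: "'m::metric_space"
  assumes "finite T" "x \<notin> T"
  obtains \<phi> :: "'m \<Rightarrow> real" where "continuous_on UNIV \<phi>" "\<And>y. 0 \<le> \<phi> y" "\<And>y. \<phi> y \<le> 1"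
    "\<phi> x = 1" "\<And>y. y \<in> T \<Longrightarrow> \<phi> y = 0"
proof (cases "T = {}")
  case True
  with that[of "\<lambda>_. 1"] show ?thesis by simp
next
  case False
  have "infdist x T \<noteq> 0"
    using assms False in_closed_iff_infdist_zero[OF finite_imp_closed] by blast
  then have pos: "infdist x T > 0" using infdist_nonneg[of x T] by linarith
  show ?thesis
  proof (rule that[of "\<lambda>y. min 1 (infdist y T / infdist x T)"])
    show "continuous_on UNIV (\<lambda>y. min 1 (infdist y T / infdist x T))"
      using pos by (intro continuous_intros continuous_on_min) auto
  qed (use pos in \<open>auto simp: infdist_nonneg\<close>)
qed

context topological_action
begin

text \<open>The ball of radius \<open>n\<close> in the Cayley graph.\<close>

primrec word_ball :: "nat \<Rightarrow> 'a set" where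
  "word_ball 0 = {\<one>}"
| "word_ball (Suc n) = word_ball n \<union> (\<Union>s\<in>S. (\<lambda>g. g \<otimes> s) ` word_ball n)"

lemma word_ball_closed: "word_ball n \<subseteq> carrier G"
  using S_closed by (induction n) auto

lemma finite_word_ball: "finite (word_ball n)"
  using finite_S by (induction n) auto

lemma one_word_ball: "\<one> \<in> word_ball n"
  by (induction n) auto

lemma word_ball_mono: "m \<le> n \<Longrightarrow> word_ball m \<subseteq> word_ball n"
  by (rule lift_Suc_mono_le) auto

text \<open>Let \<open>m j y\<close> be the maximum of \<open>\<phi>\<close> over the translates of \<open>y\<close> by the ball of radius \<open>j\<close>.
  A generator maps this ball into the next one, so \<open>m j (\<alpha> s y) \<le> m (Suc j) y\<close>; in the average
  \<open>v\<close> of \<open>m 0, \<dots>, m (n - 1)\<close> these inequalities telescope and leave an error of at most \<open>1/n\<close>.\<close>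

lemma almost_invariant_function:
  assumes uncovered:
      "\<And>F. finite F \<Longrightarrow> F \<subseteq> carrier G \<Longrightarrow> \<exists>z. \<exists>h\<in>carrier G. \<forall>g\<in>F. \<alpha> g z \<noteq> \<alpha> h z"
    and e: "e > 0"
  shows "\<exists>u z h. h \<in> carrier G \<and> (\<forall>s\<in>S. norm (\<delta> u s) \<le> e) \<and> \<delta> u h z = 1"
proof -
  obtain n :: nat where n: "n > 0" "1 / n \<le> e"
    using e by (metis less_imp_le nat_approx_posE zero_less_Suc)
  obtain z h where h: "h \<in> carrier G" and zh: "\<forall>g\<in>word_ball n. \<alpha> g z \<noteq> \<alpha> h z"
    using uncovered[OF finite_word_ball word_ball_closed] by blast
  have "\<alpha> h z \<notin> (\<lambda>g. \<alpha> g z) ` word_ball n" using zh by (metis imageE)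
  then obtain \<phi> :: "'m \<Rightarrow> real" where \<phi>: "continuous_on UNIV \<phi>" "\<And>y. 0 \<le> \<phi> y" "\<And>y. \<phi> y \<le> 1"
      "\<phi> (\<alpha> h z) = 1" "\<And>y. y \<in> (\<lambda>g. \<alpha> g z) ` word_ball n \<Longrightarrow> \<phi> y = 0"
    using continuous_separation_from_finite[OF finite_imageI[OF finite_word_ball]] by blast
  define m where "m j y = Max ((\<lambda>g. \<phi> (\<alpha> g y)) ` word_ball j)" for j y
  have m_ge: "\<phi> (\<alpha> g y) \<le> m j y" if "g \<in> word_ball j" for g j y
    unfolding m_def using that finite_word_ball by simp
  have m_le: "m j y \<le> b" if "\<And>g. g \<in> word_ball j \<Longrightarrow> \<phi> (\<alpha> g y) \<le> b" for j y b
    unfolding m_def using that finite_word_ball one_word_ball by (subst Max_le_iff) auto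
  have m_bounds: "0 \<le> m j y" "m j y \<le> 1" for j y
    using \<phi>(2)[of "\<alpha> \<one> y"] m_ge[OF one_word_ball, of y j] m_le[of j y 1] \<phi>(3) by auto
  have m_step: "m j (\<alpha> s y) \<le> m (Suc j) y" if "s \<in> S" for j s y
  proof (rule m_le)
    fix g assume g: "g \<in> word_ball j"
    have "g \<otimes> s \<in> word_ball (Suc j)" using g that by auto
    moreover have "\<alpha> (g \<otimes> s) y = \<alpha> g (\<alpha> s y)"
      using g word_ball_closed S_closed[OF that] by (intro act_mult) auto
    ultimately show "\<phi> (\<alpha> g (\<alpha> s y)) \<le> m (Suc j) y"
      using m_ge by metis
  qed
  have m_cont: "continuous_on UNIV (m j)" for j
    unfolding m_def
  proof (rule continuous_on_Max_image[OF finite_word_ball])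
    show "continuous_on UNIV (\<lambda>y. \<phi> (\<alpha> g y))" if "g \<in> word_ball j" for g
      using that word_ball_closed
      by (intro continuous_on_compose2[OF \<phi>(1)] continuous_act) auto
  qed (use one_word_ball in blast)
  define v where "v y = (\<Sum>j<n. m j y) / n" for y
  have "v \<in> bcontfun"
  proof (rule bcontfun_normI)
    show "continuous_on UNIV v"
      unfolding v_def using m_cont n by (intro continuous_intros) auto
    show "norm (v y) \<le> 1" for y
      using sum_nonneg[of "{..<n}" "\<lambda>j. m j y"] sum_bounded_above[of "{..<n}" "\<lambda>j. m j y" 1] m_bounds n
      by (simp add: v_def)
  qed
  then have u: "Bcontfun v y = v y" for y by (simp add: Bcontfun_inverse)
  have v_step: "v (\<alpha> s y) \<le> v y + 1 / n" if "s \<in> S" for s y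
  proof -
    have "(\<Sum>j<n. m j (\<alpha> s y)) \<le> (\<Sum>j<n. m (Suc j) y)"
      using m_step[OF that] by (rule sum_mono)
    also have "\<dots> = (\<Sum>j<n. m j y) + m n y - m 0 y"
      using sum.lessThan_Suc_shift[of "\<lambda>j. m j y" n] by simp
    also have "\<dots> \<le> (\<Sum>j<n. m j y) + 1"
      using m_bounds[of n y] m_bounds[of 0 y] by simp
    finally show ?thesis
      using n by (simp add: v_def field_simps)
  qed
  have "norm (\<delta> (Bcontfun v) s) \<le> e" if s: "s \<in> S" for s
  proof (rule norm_bound)
    fix y
    \<comment> \<open>the reverse estimate is \<open>v_step\<close> for the generator \<open>inv s\<close> at the point \<open>\<alpha> s y\<close>\<close>
    have "v y \<le> v (\<alpha> s y) + 1 / n"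
      using v_step[OF S_inv[OF s], of "\<alpha> s y"] act_inv(1)[OF S_closed[OF s]] by simp
    then show "norm (\<delta> (Bcontfun v) s y) \<le> e"
      using v_step[OF s, of y] n(2) by (simp add: coboundary_apply' S_closed[OF s] u abs_le_iff)
  qed
  moreover have "\<delta> (Bcontfun v) h z = 1"
  proof -
    have "m j (\<alpha> h z) = 1" for j
      using m_ge[OF one_word_ball, of "\<alpha> h z" j] m_bounds[of j "\<alpha> h z"] \<phi>(4) by (simp add: act_one)
    moreover have "m j z = 0" if "j < n" for j
    proof (rule antisym[OF m_le m_bounds(1)])
      show "\<phi> (\<alpha> g z) \<le> 0" if "g \<in> word_ball j" for g
        using \<phi>(5)[of "\<alpha> g z"] word_ball_mono[of j n] \<open>j < n\<close> that by auto
    qed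
    ultimately show ?thesis
      using n by (simp add: coboundary_apply' h u v_def)
  qed
  ultimately show ?thesis using h by blast
qed

end

section \<open>A gliding hump of coboundaries\<close>

instance bcontfun :: (metric_space, banach) banach ..

lemma convergent_geometric_increments:
  fixes c :: "nat \<Rightarrow> 'a::banach"
  assumes "\<And>m. norm (c (Suc m) - c m) \<le> (1/2)^m * K"
  shows "\<exists>l. c \<longlonglongrightarrow> l \<and> norm (l - c 0) \<le> 2 * K"
proof -
  have geo: "(\<lambda>m. (1/2)^m * K) sums (2 * K)"
    using sums_mult2[OF geometric_sums[of "1/2 :: real"], of K] by simp
  have summ: "summable (\<lambda>m. norm (c (Suc m) - c m))"
    using assms by (intro summable_comparison_test'[OF sums_summable[OF geo], of 0]) simp
  let ?s = "suminf (\<lambda>m. c (Suc m) - c m)"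
  have "(\<lambda>m. c (Suc m) - c m) sums ?s"
    using summable_norm_cancel[OF summ] by (rule summable_sums)
  then have "(\<lambda>n. c n - c 0) \<longlonglongrightarrow> ?s"
    by (simp add: sums_def sum_lessThan_telescope)
  then have "c \<longlonglongrightarrow> ?s + c 0"
    using tendsto_add[OF _ tendsto_const[of "c 0"]] by fastforce
  moreover have "norm ?s \<le> 2 * K"
    using summable_norm[OF summ] suminf_le[OF assms summ sums_summable[OF geo]] sums_unique[OF geo]
    by simp
  ultimately show ?thesis
    by (intro exI[of _ "?s + c 0"]) simp
qed

context topological_action
begin

lemma coboundary_add_scaleR:
  "g \<in> carrier G \<Longrightarrow> \<delta> (w + a *\<^sub>R u) g = \<delta> w g + a *\<^sub>R \<delta> u g"
  by (rule bcontfun_eqI) (simp add: coboundary_apply' algebra_simps)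

lemma coboundary_diff:
  "g \<in> carrier G \<Longrightarrow> \<delta> (w - u) g = \<delta> w g - \<delta> u g"
  by (rule bcontfun_eqI) (simp add: coboundary_apply')

lemma norm_coboundary_apply_le:
  "g \<in> carrier G \<Longrightarrow> \<bar>\<delta> w g x\<bar> \<le> 2 * norm w"
  using norm_bounded[of w "\<alpha> g x"] norm_bounded[of w x] by (simp add: coboundary_apply')

text \<open>\<open>L\<close> plays the role of the word length of \<open>g\<close>.\<close>

definition controls :: "real \<Rightarrow> 'a \<Rightarrow> bool" where
  "controls L g \<longleftrightarrow> (\<forall>c\<in>cocycles G \<alpha>. \<forall>e\<ge>0. (\<forall>s\<in>S. norm (c s) \<le> e) \<longrightarrow> norm (c g) \<le> L * e)"

lemma controls_mono: "controls L g \<Longrightarrow> L \<le> L' \<Longrightarrow> controls L' g"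
  unfolding controls_def by (meson mult_right_mono order_trans)

lemma exists_controls: "g \<in> carrier G \<Longrightarrow> \<exists>L. controls L g"
  using cocycle_norm_bound[of g] unfolding controls_def by blast

text \<open>The states of the recursion are pairs \<open>(w, L)\<close>: a partial sum \<open>w\<close> and a constant \<open>L\<close> that
  controls some \<open>g\<close> at which \<open>\<delta> w\<close> takes a value of at least \<open>n\<close>. The next summand is so large
  that its own coboundary outweighs the bound \<open>2 * norm w\<close> on \<open>\<delta> w\<close>, yet so nearly invariant that
  its coboundary on the generators is at most \<open>(1/2)^n / L\<close>. Dividing by \<open>L\<close> is what protects the
  earlier values: since \<open>L\<close> increases, all later summands together change \<open>\<delta> w g\<close> by at most
  \<open>2\<close>. Hence the limit cocycle takes a value of at least \<open>n - 2\<close> for every \<open>n\<close>.\<close>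

theorem almost_invariant_imp_unstable:
  assumes ai: "\<And>e. e > 0 \<Longrightarrow> \<exists>u z h. h \<in> carrier G \<and> (\<forall>s\<in>S. norm (\<delta> u s) \<le> e) \<and> \<delta> u h z = 1"
  shows "\<not> cohomologically_C0_stable G S \<alpha>"
proof
  assume stable: "cohomologically_C0_stable G S \<alpha>"
  define P where "P n p \<longleftrightarrow> snd p \<ge> 1 \<and> (\<exists>g\<in>carrier G. \<exists>x. controls (snd p) g \<and> real n \<le> \<delta> (fst p) g x)"
    for n and p :: "('m \<Rightarrow>\<^sub>C real) \<times> real"
  define Q where "Q n p q \<longleftrightarrow> snd p \<le> snd q \<and> (\<forall>s\<in>S. norm (\<delta> (fst q - fst p) s) \<le> (1/2)^n / snd p)"
    for n :: nat and p q :: "('m \<Rightarrow>\<^sub>C real) \<times> real"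
  have "\<exists>p. \<forall>n. P n (p n) \<and> Q n (p n) (p (Suc n))"
  proof (rule dependent_nat_choice)
    obtain K where "controls K \<one>" using exists_controls[OF one_closed] by blast
    then have "controls (max 1 K) \<one>" by (rule controls_mono) simp
    then show "\<exists>p. P 0 p"
      unfolding P_def by (intro exI[of _ "(0, max 1 K)"]) (auto simp: coboundary_apply' intro!: bexI[of _ \<one>])
  next
    fix p :: "('m \<Rightarrow>\<^sub>C real) \<times> real" and n
    assume p: "P n p"
    obtain w L where wL: "p = (w, L)" by fastforce
    have L: "L \<ge> 1" using p by (simp add: P_def wL)
    \<comment> \<open>\<open>2 * norm w\<close> makes up for cancellation with \<open>\<delta> w\<close>\<close>
    define a where "a = 2 * norm w + Suc n"
    have a: "a > 0" unfolding a_def by (simp add: add_nonneg_pos)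
    obtain u z h where h: "h \<in> carrier G" and u: "\<forall>s\<in>S. norm (\<delta> u s) \<le> (1/2)^n / L / a" "\<delta> u h z = 1"
      using ai[of "(1/2)^n / L / a"] a L by auto
    obtain K where K: "controls K h" using exists_controls[OF h] by blast
    let ?q = "(w + a *\<^sub>R u, max L K)"
    have "real (Suc n) \<le> \<delta> (w + a *\<^sub>R u) h z"
      using norm_coboundary_apply_le[OF h, of w z] u(2)
      by (simp add: coboundary_add_scaleR[OF h] a_def)
    then have "P (Suc n) ?q"
      unfolding P_def using L h controls_mono[OF K, of "max L K"] by auto
    moreover have "norm (\<delta> (a *\<^sub>R u) s) \<le> (1/2)^n / L" if "s \<in> S" for s
    proof -
      have "\<delta> (a *\<^sub>R u) s = a *\<^sub>R \<delta> u s"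
        using S_closed[OF that] by (intro bcontfun_eqI) (simp add: coboundary_apply' algebra_simps)
      then show ?thesis
        using u(1)[rule_format, OF that] a by (simp add: pos_le_divide_eq mult.commute del: divide_divide_eq_left)
    qed
    then have "Q n p ?q" by (simp add: Q_def wL)
    ultimately show "\<exists>q. P (Suc n) q \<and> Q n p q" by blast
  qed
  then obtain p where p: "\<And>n. P n (p n)" "\<And>n. Q n (p n) (p (Suc n))" by blast
  define w where "w = fst \<circ> p"
  define L where "L = snd \<circ> p"
  have P: "P n (w n, L n)" and Q: "Q n (w n, L n) (w (Suc n), L (Suc n))" for n
    using p by (simp_all add: w_def L_def)
  have L_step: "L n \<le> L (Suc n)" and w_step: "\<forall>s\<in>S. norm (\<delta> (w (Suc n) - w n) s) \<le> (1/2)^n / L n" for n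
    using Q[of n] unfolding Q_def fst_conv snd_conv by blast+
  have L_mono: "L m \<le> L n" if "m \<le> n" for m n
    using L_step that by (rule lift_Suc_mono_le)
  have L1: "L n \<ge> 1" for n using P[of n] unfolding P_def snd_conv by blast
  have step: "norm (\<delta> (w (Suc m)) g - \<delta> (w m) g) \<le> (1/2)^m * (K / L m)"
    if g: "g \<in> carrier G" "controls K g" for g K m
  proof -
    have "norm (\<delta> (w (Suc m) - w m) g) \<le> K * ((1/2)^m / L m)"
      using g(2)[unfolded controls_def, rule_format, OF coboundary_cocycle _ w_step[rule_format]] L1[of m]
      by simp
    then show ?thesis by (simp add: coboundary_diff[OF g(1)] algebra_simps)
  qed
  have tail: "\<exists>l. (\<lambda>m. \<delta> (w m) g) \<longlonglongrightarrow> l \<and> norm (l - \<delta> (w n) g) \<le> 2 * ((1/2)^n * (K / L n))"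
    if g: "g \<in> carrier G" "controls K g" and K: "K \<ge> 0" for g K n
  proof -
    have "norm (\<delta> (w (n + Suc m)) g - \<delta> (w (n + m)) g) \<le> (1/2)^m * ((1/2)^n * (K / L n))" for m
    proof -
      have "K / L (n + m) \<le> K / L n"
        using L_mono[of n "n + m"] L1[of n] K by (intro divide_left_mono mult_pos_pos) linarith+
      then have "(1/2)^(n + m) * (K / L (n + m)) \<le> (1/2)^(n + m) * (K / L n)"
        by (rule mult_left_mono) simp
      then show ?thesis
        using step[OF g, of "n + m"] by (simp add: power_add algebra_simps)
    qed
    from convergent_geometric_increments[of "\<lambda>m. \<delta> (w (n + m)) g", OF this]
    obtain l where "(\<lambda>m. \<delta> (w (n + m)) g) \<longlonglongrightarrow> l" "norm (l - \<delta> (w n) g) \<le> 2 * ((1/2)^n * (K / L n))"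
      by auto
    then show ?thesis
      using LIMSEQ_offset[of "\<lambda>m. \<delta> (w m) g" n l] by (auto simp: add.commute)
  qed
  have "\<exists>l. (\<lambda>m. \<delta> (w m) g) \<longlonglongrightarrow> l" if g: "g \<in> carrier G" for g
  proof -
    obtain K where "controls K g" using exists_controls[OF g] by blast
    then have "controls (max 0 K) g" by (rule controls_mono) simp
    then show ?thesis using tail[OF g, of "max 0 K"] by auto
  qed
  then obtain l where l: "\<And>g. g \<in> carrier G \<Longrightarrow> (\<lambda>m. \<delta> (w m) g) \<longlonglongrightarrow> l g"
    by metis
  define c where "c = restrict l (carrier G)"
  have lim: "(\<lambda>m. \<delta> (w m) g) \<longlonglongrightarrow> c g" if "g \<in> carrier G" for g
    using l[OF that] that by (simp add: c_def)
  have "c \<in> cocycles G \<alpha>"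
    unfolding cocycles_def
  proof (intro CollectI conjI ballI allI)
    show "c \<in> carrier G \<rightarrow>\<^sub>E UNIV" by (simp add: c_def)
    fix g h x assume gh: "g \<in> carrier G" "h \<in> carrier G"
    have "(\<lambda>m. \<delta> (w m) (g \<otimes> h) x) \<longlonglongrightarrow> c g (\<alpha> h x) + c h x"
      unfolding cocycle_mult[OF coboundary_cocycle gh]
      by (intro tendsto_add tendsto_apply_bcontfun lim gh)
    then show "c (g \<otimes> h) x = c g (\<alpha> h x) + c h x"
      using LIMSEQ_unique tendsto_apply_bcontfun[OF lim[OF m_closed[OF gh]]] by blast
  qed
  moreover have "\<exists>u. \<forall>s\<in>S. norm (c s - \<delta> u s) < e" if "e > 0" for e
  proof -
    have "\<forall>\<^sub>F m in sequentially. \<forall>s\<in>S. dist (\<delta> (w m) s) (c s) < e"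
      using tendstoD[OF lim[OF S_closed] \<open>e > 0\<close>] finite_S by (simp add: eventually_ball_finite)
    then show ?thesis
      using eventually_happens'[OF sequentially_bot] by (force simp: dist_norm norm_minus_commute)
  qed
  ultimately obtain u where u: "c = \<delta> u"
    using stable unfolding stable_iff by blast
  have "real n \<le> 2 * norm u + 2" for n
  proof -
    obtain g x where g: "g \<in> carrier G" "controls (L n) g" and x: "real n \<le> \<delta> (w n) g x"
      using P[of n] unfolding P_def fst_conv snd_conv by blast
    have "norm (c g - \<delta> (w n) g) \<le> 2 * ((1/2)^n * (L n / L n))"
      using tail[OF g, of n] L1[of n] LIMSEQ_unique[OF lim[OF g(1)]] by force
    also have "\<dots> \<le> 2"
      using L1[of n] power_le_one[of "1/2 :: real" n] by simp
    finally have "\<bar>c g x - \<delta> (w n) g x\<bar> \<le> 2"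
      using norm_bounded[of "c g - \<delta> (w n) g" x] by simp
    then show ?thesis
      using x norm_coboundary_apply_le[OF g(1), of u x] u by simp
  qed
  then show False
    using reals_Archimedean2 not_le by metis
qed

text \<open>A finite set of group elements thus suffices to reach all points of all orbits; in particular
  the orbits have bounded cardinality.\<close>

corollary stable_imp_orbits_covered:
  assumes "cohomologically_C0_stable G S \<alpha>"
  shows "\<exists>F. finite F \<and> F \<subseteq> carrier G \<and> (\<forall>x. \<forall>h\<in>carrier G. \<exists>g\<in>F. \<alpha> h x = \<alpha> g x)"
proof (rule ccontr)
  assume "\<not> ?thesis"
  then have "\<exists>z. \<exists>h\<in>carrier G. \<forall>g\<in>F. \<alpha> g z \<noteq> \<alpha> h z" if "finite F" "F \<subseteq> carrier G" for F
    using that by metis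
  from almost_invariant_imp_unstable[OF almost_invariant_function[OF this]]
  show False using assms by blast
qed

end

section \<open>Actions of the lattice\<close>

text \<open>A homomorphism with trivial restriction to \<open>K\<close> is constant on the cosets of \<open>K\<close>;
  conversely the cosets of the kernel correspond to the elements of the image.\<close>

lemma (in group_hom) finite_image_iff_finite_index_kernel:
  "finite (h ` carrier G) \<longleftrightarrow>
    (\<exists>K. subgroup K G \<and> finite (rcosets\<^bsub>G\<^esub> K) \<and> (\<forall>g\<in>K. h g = \<one>\<^bsub>H\<^esub>))"
proof
  assume fin: "finite (h ` carrier G)"
  let ?I = "H\<lparr>carrier := h ` carrier G\<rparr>"
  \<comment> \<open>the isomorphism theorem wants a surjective homomorphism\<close>
  interpret img: group_hom G ?I h
    using H.subgroup_imp_group[OF img_is_subgroup]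
    by (auto simp: group_hom_def group_hom_axioms_def hom_def)
  have "bij_betw (\<lambda>C. the_elem (h ` C)) (rcosets\<^bsub>G\<^esub> (kernel G ?I h)) (h ` carrier G)"
    using img.FactGroup_iso_set by (simp add: iso_def FactGroup_def)
  then have "finite (rcosets\<^bsub>G\<^esub> (kernel G ?I h))"
    using fin bij_betw_finite by blast
  moreover have "kernel G ?I h = kernel G H h" by (simp add: kernel_def)
  ultimately show "\<exists>K. subgroup K G \<and> finite (rcosets\<^bsub>G\<^esub> K) \<and> (\<forall>g\<in>K. h g = \<one>\<^bsub>H\<^esub>)"
    using subgroup_kernel by (intro exI[of _ "kernel G H h"]) (simp add: kernel_def)
next
  assume "\<exists>K. subgroup K G \<and> finite (rcosets\<^bsub>G\<^esub> K) \<and> (\<forall>g\<in>K. h g = \<one>\<^bsub>H\<^esub>)"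
  then obtain K where K: "subgroup K G" "finite (rcosets\<^bsub>G\<^esub> K)" "\<And>g. g \<in> K \<Longrightarrow> h g = \<one>\<^bsub>H\<^esub>"
    by blast
  have "h g \<in> (\<lambda>C. the_elem (h ` C)) ` (rcosets\<^bsub>G\<^esub> K)" if g: "g \<in> carrier G" for g
  proof (rule image_eqI)
    have "h (k \<otimes> g) = h g" if "k \<in> K" for k
      using K(3)[OF that] subgroup.mem_carrier[OF K(1) that] g by simp
    then have "h ` (K #> g) = {h g}"
      using subgroup.one_closed[OF K(1)] by (simp add: r_coset_def image_UN) blast
    then show "h g = the_elem (h ` (K #> g))" by simp
    show "K #> g \<in> rcosets\<^bsub>G\<^esub> K"
      using g by (auto simp: RCOSETS_def)
  qed
  then have "h ` carrier G \<subseteq> (\<lambda>C. the_elem (h ` C)) ` (rcosets\<^bsub>G\<^esub> K)" by blast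
  with K(2) show "finite (h ` carrier G)" by (rule finite_surj)
qed

lemma int_lattice_simps:
  "carrier int_lattice = UNIV" "v \<otimes>\<^bsub>int_lattice\<^esub> w = v + w" "\<one>\<^bsub>int_lattice\<^esub> = 0"
  by (simp_all add: int_lattice_def)

lemma int_lattice_pow: "v [^]\<^bsub>int_lattice\<^esub> (n::int) = n *s v"
proof -
  interpret group int_lattice by (rule group_int_lattice)
  have nat: "v [^]\<^bsub>int_lattice\<^esub> (n::nat) = int n *s v" for n
    by (induction n) (simp_all add: int_lattice_simps vec_eq_iff algebra_simps)
  have inv: "inv\<^bsub>int_lattice\<^esub> v = - v" for v :: "int ^ 'a"
    by (rule inv_equality) (simp_all add: int_lattice_simps)
  show ?thesis
  proof (cases n)
    case (nonneg m)
    then show ?thesis by (simp add: int_pow_int nat)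
  next
    case (neg m)
    have "v [^]\<^bsub>int_lattice\<^esub> (- int (Suc m)) = - (v [^]\<^bsub>int_lattice\<^esub> Suc m)"
      by (subst int_pow_neg) (simp_all only: int_pow_int inv int_lattice_simps UNIV_I)
    then show ?thesis
      unfolding neg nat by (simp add: vec_eq_iff)
  qed
qed

lemma generate_int_lattice_axes: "generate int_lattice (range (\<lambda>i. axis i 1)) = UNIV"
proof -
  let ?H = "generate int_lattice (range (\<lambda>i::'a. axis i (1::int)))"
  interpret group int_lattice by (rule group_int_lattice)
  interpret H: subgroup ?H int_lattice
    by (rule generate_is_subgroup) (simp add: int_lattice_simps)
  have axis: "axis i n \<in> ?H" for i n
  proof -
    have "axis i (1::int) [^]\<^bsub>int_lattice\<^esub> n \<in> ?H"
      by (intro subgroup_int_pow_closed H.subgroup_axioms generate.incl rangeI)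
    also have "axis i (1::int) [^]\<^bsub>int_lattice\<^esub> n = axis i n"
      by (simp add: int_lattice_pow vec_eq_iff axis_def)
    finally show ?thesis .
  qed
  have sum: "(\<Sum>i\<in>I. axis i (v $ i)) \<in> ?H" for I and v :: "int ^ 'a"
  proof (induction I rule: infinite_finite_induct)
    case (insert i I)
    then show ?case using H.m_closed[OF axis] by (simp add: int_lattice_simps)
  qed (use H.one_closed in \<open>simp_all add: int_lattice_simps\<close>)
  have "v \<in> ?H" for v
  proof -
    have "v = (\<Sum>i\<in>UNIV. axis i (v $ i))"
      by (simp add: vec_eq_iff axis_def)
    then show ?thesis using sum[of v UNIV] by metis
  qed
  then show ?thesis by blast
qed

locale lattice_action = topological_action int_lattice \<alpha> S
  for \<alpha> :: "int ^ 'k::finite \<Rightarrow> 'm::metric_space \<Rightarrow> 'm" and S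
begin

lemma act_zero: "\<alpha> 0 x = x" and act_add: "\<alpha> (v + w) x = \<alpha> v (\<alpha> w x)"
  using act_one act_mult[of v w x] by (simp_all add: int_lattice_simps)

lemma act_scale_fixed:
  assumes "\<alpha> v x = x"
  shows "\<alpha> (int n *s v) x = x"
proof (induction n)
  case (Suc n)
  have "int (Suc n) *s v = int n *s v + v" by (simp add: vec_eq_iff algebra_simps)
  then show ?case using Suc assms by (simp add: act_add)
qed (simp add: act_zero)

text \<open>Pigeonhole on the points \<open>j v \<cdot> x\<close> for \<open>0 \<le> j \<le> card F\<close>. The factorial is a common multiple of
  all differences that can occur, so it serves every \<open>v\<close> and \<open>x\<close> at once.\<close>

lemma orbits_covered_imp_multiples_trivial:
  assumes F: "finite F" and cover: "\<And>x v. \<exists>g\<in>F. \<alpha> v x = \<alpha> g x"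
  shows "\<alpha> (fact (card F) *s v) x = x"
proof -
  have "(\<lambda>j. \<alpha> (int j *s v) x) ` {..card F} \<subseteq> (\<lambda>g. \<alpha> g x) ` F"
  proof (rule image_subsetI)
    fix j
    obtain g where "g \<in> F" "\<alpha> (int j *s v) x = \<alpha> g x" using cover by blast
    then show "\<alpha> (int j *s v) x \<in> (\<lambda>g. \<alpha> g x) ` F" by (rule image_eqI[rotated])
  qed
  then have "card ((\<lambda>j. \<alpha> (int j *s v) x) ` {..card F}) \<le> card F"
    using F by (meson card_image_le card_mono finite_imageI order_trans)
  then have "\<not> inj_on (\<lambda>j. \<alpha> (int j *s v) x) {..card F}"
    by (intro pigeonhole) simp
  then obtain i j where ij: "i < j" "j \<le> card F" "\<alpha> (int i *s v) x = \<alpha> (int j *s v) x"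
    unfolding inj_on_def by (metis atMost_iff linorder_neqE_nat)
  have "int (j - i) *s v = - (int i *s v) + int j *s v"
    using ij(1) by (simp add: vec_eq_iff of_nat_diff algebra_simps)
  then have "\<alpha> (int (j - i) *s v) x = \<alpha> (- (int i *s v)) (\<alpha> (int i *s v) x)"
    by (simp only: act_add ij(3))
  also have "\<dots> = x"
    unfolding act_add[symmetric] by (simp only: left_minus act_zero)
  finally have fixed: "\<alpha> (int (j - i) *s v) x = x" .
  have "j - i dvd fact (card F)"
    using ij by (intro dvd_fact) auto
  then obtain q where q: "(fact (card F) :: nat) = (j - i) * q" by blast
  have "(fact (card F) :: int) = int (j - i) * int q"
    using arg_cong[OF q, of int] by (simp only: of_nat_fact of_nat_mult)
  then have "fact (card F) *s v = int q *s (int (j - i) *s v)"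
    by (simp only: vector_smult_assoc mult.commute)
  then show ?thesis using act_scale_fixed[OF fixed] by simp
qed

text \<open>Each \<open>v\<close> acts like its coordinatewise remainder modulo \<open>n\<close>.\<close>

lemma finite_image_if_multiples_trivial:
  assumes "n > 0" and triv: "\<And>v x. \<alpha> (n *s v) x = x"
  shows "finite (range \<alpha>)"
proof -
  define D where "D = {v :: int ^ 'k. \<forall>i. v $ i \<in> {0..<n}}"
  have "D \<subseteq> vec_lambda ` (UNIV \<rightarrow>\<^sub>E {0..<n})"
  proof
    fix v assume "v \<in> D"
    then have "vec_nth v \<in> UNIV \<rightarrow>\<^sub>E {0..<n}" by (auto simp: D_def)
    then show "v \<in> vec_lambda ` (UNIV \<rightarrow>\<^sub>E {0..<n})"
      by (metis image_eqI vec_nth_inverse)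
  qed
  then have "finite D" by (rule finite_subset) (simp add: finite_PiE)
  moreover have "\<alpha> v \<in> \<alpha> ` D" for v
  proof (rule image_eqI[of _ _ "\<chi> i. v $ i mod n"])
    have v: "v = (\<chi> i. v $ i mod n) + n *s (\<chi> i. v $ i div n)"
      by (simp add: vec_eq_iff)
    show "\<alpha> v = \<alpha> (\<chi> i. v $ i mod n)"
      by (rule ext) (subst v, simp only: act_add triv)
  qed (use \<open>n > 0\<close> in \<open>simp add: D_def\<close>)
  then have "range \<alpha> \<subseteq> \<alpha> ` D" by blast
  ultimately show ?thesis using finite_surj by blast
qed

theorem stable_iff_finite_image:
  "cohomologically_C0_stable int_lattice S \<alpha> \<longleftrightarrow> finite (range \<alpha>)"
proof
  assume "cohomologically_C0_stable int_lattice S \<alpha>"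
  then obtain F where F: "finite F" "\<forall>x. \<forall>v\<in>carrier int_lattice. \<exists>g\<in>F. \<alpha> v x = \<alpha> g x"
    using stable_imp_orbits_covered by blast
  have "\<alpha> (fact (card F) *s v) x = x" for v x
    using F(2) by (intro orbits_covered_imp_multiples_trivial[OF F(1)]) (simp add: int_lattice_simps)
  then show "finite (range \<alpha>)"
    by (rule finite_image_if_multiples_trivial[rotated]) simp
next
  assume "finite (range \<alpha>)"
  then show "cohomologically_C0_stable int_lattice S \<alpha>"
    using finite_image_imp_stable by (simp add: int_lattice_simps)
qed

end

theorem corollary1p1:
  fixes \<alpha> :: "int ^ 'k::finite \<Rightarrow> 'm::metric_space \<Rightarrow> 'm"
    and f :: "'k \<Rightarrow> 'm \<Rightarrow> 'm"
    and S :: "(int ^ 'k) set"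
  assumes compact: "compact (UNIV :: 'm set)"
    and action: "\<alpha> \<in> hom int_lattice homeo_group"
    and generators: "\<And>i. f i = \<alpha> (axis i 1)"
    and S: "symmetric_generating_set int_lattice S"
  shows "(cohomologically_C0_stable int_lattice S \<alpha> \<longleftrightarrow>
            (\<exists>\<Lambda>. subgroup \<Lambda> int_lattice \<and> finite (rcosets\<^bsub>int_lattice\<^esub> \<Lambda>) \<and>
                 (\<forall>v\<in>\<Lambda>. \<forall>x. \<alpha> v x = x)))
       \<and> (cohomologically_C0_stable int_lattice S \<alpha> \<longleftrightarrow>
            finite (generate homeo_group (range f)))"
proof -
  have S_nonempty: "S \<noteq> {}"
  proof
    assume "S = {}"
    then have "(UNIV :: (int ^ 'k) set) = {0}"
      using S group.generate_empty[OF group_int_lattice]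
      unfolding symmetric_generating_set_def int_lattice_simps by metis
    then have "(1 :: int ^ 'k) = 0"
      by (metis UNIV_I singletonD)
    then show False by (simp add: vec_eq_iff)
  qed
  interpret lattice_action \<alpha> S
    by (intro lattice_action.intro topological_action.intro topological_action_axioms.intro
        group_int_lattice action S S_nonempty)
  have "f ` UNIV = \<alpha> ` range (\<lambda>i. axis i 1)"
    by (auto simp: generators)
  then have "generate homeo_group (range f) = range \<alpha>"
    using hom.generate_img[of "range (\<lambda>i. axis i 1)"]
    by (simp add: generate_int_lattice_axes int_lattice_simps)
  moreover have "(\<forall>x. \<alpha> v x = x) \<longleftrightarrow> \<alpha> v = \<one>\<^bsub>homeo_group\<^esub>" for v
    by (auto simp: homeo_group_def)
  ultimately show ?thesis
    using hom.finite_image_iff_finite_index_kernel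
    unfolding stable_iff_finite_image int_lattice_simps by (simp only: simp_thms)
qed

end
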